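(* For every $n\ge 4$, the identities \[ (x^* )^*\approx x,\quad (xy)^*\approx y^*x^*,\quad xhyk\,xy\,sxty\approx xhyk\,yx\,sxty,\quad xhyk\,xy\,sytx\approx xhyk\,yx\,sytx \] constitute an identity basis for $(\mathsf{baxt}_n,{}^{\sharp})$.
   Context: Baxter monoid: for $n\ge 1$ let $\mathcal{A}_n=\{1<2<\cdots<n\}$ and let $\mathcal{A}_n^{\star}$ be the free monoid on $\mathcal{A}_n$. Then $\mathsf{baxt}_n=\mathcal{A}_n^{\star}/\!\equiv$, where $\equiv$ is the congruence generated by all pairs $(c\mathbf{u}ad\mathbf{v}b,\ c\mathbf{u}da\mathbf{v}b)$ with $a\le b<c\le d$ and $(b\mathbf{u}da\mathbf{v}c,\ b\mathbf{u}ad\mathbf{v}c)$ with $a<b\le c<d$, where $a,b,c,d\in\mathcal{A}_n$, $\mathbf{u},\mathbf{v}\in\mathcal{A}_n^{\star}$. Schützenberger's involution $^{\sharp}$ on $\mathsf{baxt}_n$ is induced by $i^{\sharp}=n+1-i$ and $(w_1\cdots w_k)^{\sharp}=w_k^{\sharp}\cdots w_1^{\sharp}$. Terms and identities: $\mathcal{X}$ is a countably infinite alphabet (here $x,y,h,k,s,t\in\mathcal{X}$ are distinct). $\mathsf{T}(\mathcal{X})$ is the smallest set containing $\mathcal{X}$ and the empty term $\emptyset$ and closed under (associative) concatenation and $^*$; the empty term is neutral for concatenation, $\emptyset^*=\emptyset$, and it is evaluated as the unit element. An identity is an expression $\mathbf{s}\approx\mathbf{t}$ with $\mathbf{s},\mathbf{t}$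 nonempty terms; an involution monoid $(M,{}^* )$ satisfies it if every substitution $\mathcal{X}\to M$ gives both sides the same value. $\mathbf{s}\approx\mathbf{t}$ is directly deducible from $\mathbf{p}\approx\mathbf{q}$ if for some substitution $\varphi:\mathcal{X}\to\mathsf{T}(\mathcal{X})$ (values may be empty), $\varphi(\mathbf{p})$ is a subterm of $\mathbf{s}$ and replacing this subterm by $\varphi(\mathbf{q})$ gives $\mathbf{t}$; it is deducible from a set $\Sigma$ if there is a finite sequence of terms from $\mathbf{s}$ to $\mathbf{t}$ in which each consecutive pair is directly deducible from an identity of $\Sigma$ (used in either direction). A set $\Sigma$ of identities of $(M,{}^* )$ is an identity basis for $(M,{}^* )$ if every identity satisfied by $(M,{}^* )$ is deducible from $\Sigma$. *)

theory Defs
  imports "HOL-Algebra.Group"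
begin

text \<open>
  The alphabet is the type of natural numbers. The elements of \<open>T(X)\<close> are represented by
  normal forms modulo associativity of concatenation, neutrality of the empty term and
  \<open>\<emptyset>* = \<emptyset>\<close>: a term is the list of its factors, concatenation is append, the empty
  term is the empty list, and a factor is a letter or a starred nonempty term, where
  \<open>Star a as\<close> stands for \<open>(a # as)*\<close>. No further laws are built in; in particular
  \<open>(x*)*\<close> and \<open>x\<close> are different terms.
\<close>

datatype factor = Var nat | Star factor "factor list"

type_synonym iterm = "factor list"

fun star :: "iterm \<Rightarrow> iterm" where
  "star [] = []"
| "star (a # as) = [Star a as]"

primrec subst_factor :: "(nat \<Rightarrow> iterm) \<Rightarrow> factor \<Rightarrow> iterm" where
  "subst_factor \<phi> (Var x) = \<phi> x"
| "subst_factor \<phi> (Star a as) = star (subst_factor \<phi> a @ concat (map (subst_factor \<phi>) as))"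

definition subst_term :: "(nat \<Rightarrow> iterm) \<Rightarrow> iterm \<Rightarrow> iterm" where
  "subst_term \<phi> t = concat (map (subst_factor \<phi>) t)"

lemma subst_term_simps [simp]:
  "subst_term \<phi> [] = []"
  "subst_term \<phi> [Var x] = \<phi> x"
  "subst_term \<phi> (s @ t) = subst_term \<phi> s @ subst_term \<phi> t"
  "subst_term \<phi> (star t) = star (subst_term \<phi> t)"
  by (simp_all add: subst_term_def, cases t, simp_all)

lemma iterm_induct [case_names empty var conc star]:
  assumes empty: "P []"
    and var: "\<And>x. P [Var x]"
    and conc: "\<And>s t. P s \<Longrightarrow> P t \<Longrightarrow> P (s @ t)"
    and star: "\<And>t. P t \<Longrightarrow> P (star t)"
  shows "P (t :: iterm)"
proof -
  have list: "P as" if "\<And>a. a \<in> set as \<Longrightarrow> P [a]" for as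
    using that
  proof (induction as)
    case Nil
    show ?case by (rule empty)
  next
    case (Cons a as)
    then have "P ([a] @ as)" by (intro conc) auto
    then show ?case by simp
  qed
  have "P [a]" for a
  proof (induction a)
    case (Var x)
    show ?case by (rule var)
  next
    case (Star a as)
    have "P (a # as)" by (rule list) (use Star in auto)
    then have "P (star (a # as))" by (rule star)
    then show ?case by simp
  qed
  then show ?thesis by (rule list)
qed

record 'a invol_monoid = "'a monoid" +
  invol :: "'a \<Rightarrow> 'a"

locale involution_monoid = monoid M for M :: "('a, 'b) invol_monoid_scheme" (structure) +
  assumes invol_closed: "a \<in> carrier M \<Longrightarrow> invol M a \<in> carrier M"
    and invol_invol: "a \<in> carrier M \<Longrightarrow> invol M (invol M a) = a"
    and invol_mult: "a \<in> carrier M \<Longrightarrow> b \<in> carrier M \<Longrightarrow>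
      invol M (a \<otimes> b) = invol M b \<otimes> invol M a"

definition mprod :: "('a, 'b) monoid_scheme \<Rightarrow> 'a list \<Rightarrow> 'a" where
  "mprod M as = foldr (mult M) as (one M)"

primrec eval_factor :: "('a, 'b) invol_monoid_scheme \<Rightarrow> (nat \<Rightarrow> 'a) \<Rightarrow> factor \<Rightarrow> 'a" where
  "eval_factor M \<theta> (Var x) = \<theta> x"
| "eval_factor M \<theta> (Star a as) =
     invol M (mult M (eval_factor M \<theta> a) (mprod M (map (eval_factor M \<theta>) as)))"

definition eval_term :: "('a, 'b) invol_monoid_scheme \<Rightarrow> (nat \<Rightarrow> 'a) \<Rightarrow> iterm \<Rightarrow> 'a" where
  "eval_term M \<theta> t = mprod M (map (eval_factor M \<theta>) t)"

definition satisfies :: "('a, 'b) invol_monoid_scheme \<Rightarrow> iterm \<Rightarrow> iterm \<Rightarrow> bool" where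
  "satisfies M s t \<longleftrightarrow>
     (\<forall>\<theta>. (\<forall>x. \<theta> x \<in> carrier M) \<longrightarrow> eval_term M \<theta> s = eval_term M \<theta> t)"

context involution_monoid
begin

lemma invol_one: "invol M \<one> = \<one>"
  by (metis invol_closed invol_invol invol_mult l_one one_closed r_one)

lemma mprod_closed: "set as \<subseteq> carrier M \<Longrightarrow> mprod M as \<in> carrier M"
  by (induction as) (auto simp: mprod_def)

lemma mprod_append:
  "set as \<subseteq> carrier M \<Longrightarrow> set bs \<subseteq> carrier M \<Longrightarrow> mprod M (as @ bs) = mprod M as \<otimes> mprod M bs"
proof (induction as)
  case Nil
  then show ?case using mprod_closed[of bs] by (simp add: mprod_def)
next
  case (Cons a as)
  then show ?case
    using mprod_closed[of bs] mprod_closed[of as] by (simp add: mprod_def m_assoc)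
qed

lemma eval_factor_closed:
  assumes "\<And>x. \<theta> x \<in> carrier M"
  shows "eval_factor M \<theta> a \<in> carrier M"
proof (induction a)
  case (Var x)
  then show ?case using assms by simp
next
  case (Star a as)
  then have "mprod M (map (eval_factor M \<theta>) as) \<in> carrier M"
    by (intro mprod_closed) auto
  with Star show ?case by (auto intro: invol_closed)
qed

lemma eval_term_simps:
  assumes "\<And>x. \<theta> x \<in> carrier M"
  shows "eval_term M \<theta> t \<in> carrier M"
    and "eval_term M \<theta> [] = \<one>"
    and "eval_term M \<theta> [Var x] = \<theta> x"
    and "eval_term M \<theta> (s @ t) = eval_term M \<theta> s \<otimes> eval_term M \<theta> t"
    and "eval_term M \<theta> (star t) = invol M (eval_term M \<theta> t)"
proof -
  have cl: "set (map (eval_factor M \<theta>) u) \<subseteq> carrier M" for u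
    using eval_factor_closed[OF assms] by auto
  show "eval_term M \<theta> t \<in> carrier M"
    unfolding eval_term_def by (rule mprod_closed[OF cl])
  show "eval_term M \<theta> [] = \<one>" by (simp add: eval_term_def mprod_def)
  show "eval_term M \<theta> [Var x] = \<theta> x" using assms by (simp add: eval_term_def mprod_def)
  show "eval_term M \<theta> (s @ t) = eval_term M \<theta> s \<otimes> eval_term M \<theta> t"
    unfolding eval_term_def map_append by (rule mprod_append[OF cl cl])
  show "eval_term M \<theta> (star t) = invol M (eval_term M \<theta> t)"
  proof (cases t)
    case Nil
    then show ?thesis by (simp add: eval_term_def mprod_def invol_one)
  next
    case (Cons a as)
    have "eval_factor M \<theta> (Star a as) \<in> carrier M" by (rule eval_factor_closed[OF assms])
    with Cons show ?thesis by (simp add: eval_term_def mprod_def)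
  qed
qed

end

text \<open>
  \<open>replaces p q s t\<close>: the term \<open>t\<close> arises from \<open>s\<close> by replacing one occurrence of the
  subterm \<open>p\<close> by \<open>q\<close>.
\<close>

inductive replaces :: "iterm \<Rightarrow> iterm \<Rightarrow> iterm \<Rightarrow> iterm \<Rightarrow> bool" for p q where
  here: "replaces p q p q"
| conc: "replaces p q s t \<Longrightarrow> replaces p q (u @ s @ v) (u @ t @ v)"
| star: "replaces p q s t \<Longrightarrow> replaces p q (star s) (star t)"

definition directly_deducible :: "iterm \<Rightarrow> iterm \<Rightarrow> iterm \<Rightarrow> iterm \<Rightarrow> bool" where
  "directly_deducible p q s t \<longleftrightarrow> (\<exists>\<phi>. replaces (subst_term \<phi> p) (subst_term \<phi> q) s t)"

definition deducible :: "(iterm \<times> iterm) set \<Rightarrow> iterm \<Rightarrow> iterm \<Rightarrow> bool" where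
  "deducible \<Sigma> =
     (\<lambda>s t. \<exists>(p, q) \<in> \<Sigma>. directly_deducible p q s t \<or> directly_deducible q p s t)\<^sup>*\<^sup>*"

definition identity_basis ::
    "('a, 'b) invol_monoid_scheme \<Rightarrow> (iterm \<times> iterm) set \<Rightarrow> bool" where
  "identity_basis M \<Sigma> \<longleftrightarrow>
     (\<forall>(p, q) \<in> \<Sigma>. p \<noteq> [] \<and> q \<noteq> [] \<and> satisfies M p q) \<and>
     (\<forall>s t. s \<noteq> [] \<longrightarrow> t \<noteq> [] \<longrightarrow> satisfies M s t \<longrightarrow> deducible \<Sigma> s t)"

definition words :: "nat \<Rightarrow> nat list set" where
  "words n = lists {1..n}"

inductive baxter_cong :: "nat \<Rightarrow> nat list \<Rightarrow> nat list \<Rightarrow> bool" for n where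
  rel1: "\<lbrakk>{a, b, c, d} \<subseteq> {1..n}; u \<in> words n; v \<in> words n; a \<le> b; b < c; c \<le> d\<rbrakk> \<Longrightarrow>
    baxter_cong n ([c] @ u @ [a, d] @ v @ [b]) ([c] @ u @ [d, a] @ v @ [b])"
| rel2: "\<lbrakk>{a, b, c, d} \<subseteq> {1..n}; u \<in> words n; v \<in> words n; a < b; b \<le> c; c < d\<rbrakk> \<Longrightarrow>
    baxter_cong n ([b] @ u @ [d, a] @ v @ [c]) ([b] @ u @ [a, d] @ v @ [c])"
| refl: "w \<in> words n \<Longrightarrow> baxter_cong n w w"
| sym: "baxter_cong n w w' \<Longrightarrow> baxter_cong n w' w"
| trans: "\<lbrakk>baxter_cong n w w'; baxter_cong n w' w''\<rbrakk> \<Longrightarrow> baxter_cong n w w''"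
| cong: "\<lbrakk>baxter_cong n w w'; baxter_cong n z z'\<rbrakk> \<Longrightarrow> baxter_cong n (w @ z) (w' @ z')"

definition baxter_rel :: "nat \<Rightarrow> (nat list \<times> nat list) set" where
  "baxter_rel n = {(w, w'). baxter_cong n w w'}"

definition sharp_word :: "nat \<Rightarrow> nat list \<Rightarrow> nat list" where
  "sharp_word n w = rev (map (\<lambda>i. n + 1 - i) w)"

definition baxt :: "nat \<Rightarrow> nat list set invol_monoid" where
  "baxt n =
    \<lparr>carrier = words n // baxter_rel n,
     mult = (\<lambda>A B. \<Union>w\<in>A. \<Union>z\<in>B. baxter_rel n `` {w @ z}),
     one = baxter_rel n `` {[]},
     invol = (\<lambda>A. \<Union>w\<in>A. baxter_rel n `` {sharp_word n w})\<rparr>"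

lemma baxter_cong_words: "baxter_cong n w w' \<Longrightarrow> w \<in> words n \<and> w' \<in> words n"
  by (induction rule: baxter_cong.induct) (auto simp: words_def)

lemma equiv_baxter_rel: "equiv (words n) (baxter_rel n)"
proof (rule equivI)
  show "baxter_rel n \<subseteq> words n \<times> words n"
    using baxter_cong_words by (auto simp: baxter_rel_def)
  show "refl_on (words n) (baxter_rel n)"
    by (simp add: baxter_rel_def refl_on_def baxter_cong.refl)
  show "sym (baxter_rel n)"
    unfolding sym_def baxter_rel_def using baxter_cong.sym by blast
  show "trans (baxter_rel n)"
    unfolding trans_def baxter_rel_def using baxter_cong.trans by blast
qed

lemma sharp_word_words: "w \<in> words n \<Longrightarrow> sharp_word n w \<in> words n"
  by (induction w) (auto simp: words_def sharp_word_def)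

lemma sharp_word_append: "sharp_word n (w @ z) = sharp_word n z @ sharp_word n w"
  by (simp add: sharp_word_def)

lemma sharp_word_sharp_word: "w \<in> words n \<Longrightarrow> sharp_word n (sharp_word n w) = w"
  by (induction w) (simp_all add: words_def sharp_word_def)

lemma baxter_cong_sharp: "baxter_cong n w w' \<Longrightarrow> baxter_cong n (sharp_word n w) (sharp_word n w')"
proof (induction rule: baxter_cong.induct)
  case (rel1 a b c d u v)
  have "baxter_cong n
     ([n+1-b] @ sharp_word n v @ [n+1-d, n+1-a] @ sharp_word n u @ [n+1-c])
     ([n+1-b] @ sharp_word n v @ [n+1-a, n+1-d] @ sharp_word n u @ [n+1-c])"
    by (rule baxter_cong.rel1) (use rel1 sharp_word_words in auto)
  then show ?case by (simp add: sharp_word_def)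
next
  case (rel2 a b c d u v)
  have "baxter_cong n
     ([n+1-c] @ sharp_word n v @ [n+1-a, n+1-d] @ sharp_word n u @ [n+1-b])
     ([n+1-c] @ sharp_word n v @ [n+1-d, n+1-a] @ sharp_word n u @ [n+1-b])"
    by (rule baxter_cong.rel2) (use rel2 sharp_word_words in auto)
  then show ?case by (simp add: sharp_word_def)
next
  case (refl w)
  then show ?case by (rule baxter_cong.refl[OF sharp_word_words])
next
  case (sym w w')
  show ?case by (rule baxter_cong.sym[OF sym.IH])
next
  case (trans w w' w'')
  show ?case by (rule baxter_cong.trans[OF trans.IH])
next
  case (cong w w' z z')
  show ?case unfolding sharp_word_append by (rule baxter_cong.cong[OF cong.IH(2) cong.IH(1)])
qed

lemma baxt_mult_class:
  assumes "w \<in> words n" "z \<in> words n"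
  shows "mult (baxt n) (baxter_rel n `` {w}) (baxter_rel n `` {z}) = baxter_rel n `` {w @ z}"
proof -
  have "congruent2 (baxter_rel n) (baxter_rel n) (\<lambda>w z. baxter_rel n `` {w @ z})"
  proof (rule congruent2I')
    fix y1 z1 y2 z2
    assume "(y1, z1) \<in> baxter_rel n" "(y2, z2) \<in> baxter_rel n"
    then have "(y1 @ y2, z1 @ z2) \<in> baxter_rel n"
      by (simp add: baxter_rel_def baxter_cong.cong)
    then show "baxter_rel n `` {y1 @ y2} = baxter_rel n `` {z1 @ z2}"
      by (rule equiv_class_eq[OF equiv_baxter_rel])
  qed
  from UN_equiv_class2[OF equiv_baxter_rel equiv_baxter_rel this assms]
  show ?thesis by (simp add: baxt_def)
qed

lemma baxt_invol_class:
  assumes "w \<in> words n"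
  shows "invol (baxt n) (baxter_rel n `` {w}) = baxter_rel n `` {sharp_word n w}"
proof -
  have "congruent (baxter_rel n) (\<lambda>w. baxter_rel n `` {sharp_word n w})"
  proof (rule congruentI)
    fix y z
    assume "(y, z) \<in> baxter_rel n"
    then have "(sharp_word n y, sharp_word n z) \<in> baxter_rel n"
      by (simp add: baxter_rel_def baxter_cong_sharp)
    then show "baxter_rel n `` {sharp_word n y} = baxter_rel n `` {sharp_word n z}"
      by (rule equiv_class_eq[OF equiv_baxter_rel])
  qed
  from UN_equiv_class[OF equiv_baxter_rel this assms]
  show ?thesis by (simp add: baxt_def)
qed

lemma baxt_one_class: "one (baxt n) = baxter_rel n `` {[]}"
  by (simp add: baxt_def)

lemma baxt_carrier_class:
  "A \<in> carrier (baxt n) \<longleftrightarrow> (\<exists>w\<in>words n. A = baxter_rel n `` {w})"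
  by (auto simp: baxt_def quotient_def)

lemma words_append: "w \<in> words n \<Longrightarrow> z \<in> words n \<Longrightarrow> w @ z \<in> words n"
  by (simp add: words_def)

lemma words_Nil: "[] \<in> words n"
  by (simp add: words_def)

lemma involution_monoid_baxt: "involution_monoid (baxt n)"
proof -
  note cls = baxt_carrier_class baxt_mult_class baxt_invol_class baxt_one_class
    words_append words_Nil sharp_word_words sharp_word_append sharp_word_sharp_word
  show ?thesis
  proof (intro involution_monoid.intro monoid.intro involution_monoid_axioms.intro)
    fix A B assume "A \<in> carrier (baxt n)" "B \<in> carrier (baxt n)"
    then obtain w z where *: "w \<in> words n" "z \<in> words n"
        "A = baxter_rel n `` {w}" "B = baxter_rel n `` {z}"
      unfolding baxt_carrier_class by blast
    show "mult (baxt n) A B \<in> carrier (baxt n)"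
      using * words_append[of w n z] by (auto simp: baxt_mult_class baxt_carrier_class)
    show "invol (baxt n) (mult (baxt n) A B) =
        mult (baxt n) (invol (baxt n) B) (invol (baxt n) A)"
      using * by (simp add: cls)
  next
    fix A B C
    assume "A \<in> carrier (baxt n)" "B \<in> carrier (baxt n)" "C \<in> carrier (baxt n)"
    then obtain w z y where *: "w \<in> words n" "z \<in> words n" "y \<in> words n"
        "A = baxter_rel n `` {w}" "B = baxter_rel n `` {z}" "C = baxter_rel n `` {y}"
      unfolding baxt_carrier_class by blast
    then show "mult (baxt n) (mult (baxt n) A B) C = mult (baxt n) A (mult (baxt n) B C)"
      by (simp add: baxt_mult_class words_append)
  next
    show "one (baxt n) \<in> carrier (baxt n)"
      using words_Nil by (auto simp: baxt_one_class baxt_carrier_class)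
  next
    fix A assume "A \<in> carrier (baxt n)"
    then obtain w where *: "w \<in> words n" "A = baxter_rel n `` {w}"
      unfolding baxt_carrier_class by blast
    show "mult (baxt n) (one (baxt n)) A = A" "mult (baxt n) A (one (baxt n)) = A"
      using * by (simp_all add: baxt_one_class baxt_mult_class words_Nil)
    show "invol (baxt n) A \<in> carrier (baxt n)"
      using * sharp_word_words[of w n] by (auto simp: baxt_invol_class baxt_carrier_class)
    show "invol (baxt n) (invol (baxt n) A) = A"
      using * by (simp add: baxt_invol_class sharp_word_words sharp_word_sharp_word)
  qed
qed

end

theory Submission
  imports Defs "HOL-Library.Multiset"
begin

text \<open>
  By the first two identities every term is equal to a word over letters and starred letters.
  The last two identities allow two adjacent factors to be exchanged whenever both of them
  occur before and after the exchanged pair. Up to such exchanges, a word is determined by its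
  content and, for all factors \<open>p \<noteq> q\<close>, by the number of \<open>p\<close> before the first \<open>q\<close> and the number
  of \<open>p\<close> after the last \<open>q\<close>. For letters \<open>a < d\<close>, the Baxter congruence preserves
  the number of \<open>a\<close> before the first letter in \<open>{a<..d}\<close> and the number of \<open>d\<close> after the last
  letter in \<open>{a..<d}\<close>. As \<open>1, 2, n - 1, n\<close> are distinct, all the numbers above are
  recovered by substitutions sending \<open>p, q\<close> to \<open>1, 2\<close>, or to \<open>1, n\<close> if one of them
  is the other one starred.
\<close>

section \<open>Exchanging middle occurrences\<close>

inductive mid_swap :: "'a list \<Rightarrow> 'a list \<Rightarrow> bool" where
  mid_swapI: "{a, b} \<subseteq> set u \<Longrightarrow> {a, b} \<subseteq> set v \<Longrightarrow> mid_swap (u @ [a, b] @ v) (u @ [b, a] @ v)"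

lemma mid_swap_move:
  assumes "insert a (set l) \<subseteq> set u" "insert a (set l) \<subseteq> set v"
  shows "mid_swap\<^sup>*\<^sup>* (u @ l @ [a] @ v) (u @ [a] @ l @ v)"
  using assms
proof (induction l arbitrary: v rule: rev_induct)
  case Nil
  then show ?case by simp
next
  case (snoc c l)
  have "mid_swap ((u @ l) @ [c, a] @ v) ((u @ l) @ [a, c] @ v)"
    by (rule mid_swapI) (use snoc.prems in auto)
  moreover have "mid_swap\<^sup>*\<^sup>* (u @ l @ [a] @ (c # v)) (u @ [a] @ l @ (c # v))"
    by (rule snoc.IH) (use snoc.prems in auto)
  ultimately show ?case by (simp add: converse_rtranclp_into_rtranclp)
qed

text \<open>The letters of \<open>l\<close> are carried over \<open>k\<close> one at a time,
  starting with the first; each letter already moved joins the left context \<open>u\<close>. This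
  turns exchanges of single letters into exchanges of arbitrary substituted words.\<close>

lemma mid_swap_blocks:
  assumes "set k \<union> set l \<subseteq> set u" "set k \<union> set l \<subseteq> set v"
  shows "mid_swap\<^sup>*\<^sup>* (u @ k @ l @ v) (u @ l @ k @ v)"
  using assms
proof (induction l arbitrary: u)
  case Nil
  then show ?case by simp
next
  case (Cons a l)
  have "mid_swap\<^sup>*\<^sup>* (u @ k @ [a] @ (l @ v)) (u @ [a] @ k @ (l @ v))"
    by (rule mid_swap_move) (use Cons.prems in auto)
  moreover have "mid_swap\<^sup>*\<^sup>* ((u @ [a]) @ k @ l @ v) ((u @ [a]) @ l @ k @ v)"
    by (rule Cons.IH) (use Cons.prems in auto)
  ultimately show ?case by simp
qed

text \<open>If \<open>q\<close> does not occur in \<open>w\<close>, nothing stops the scan and the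
  value is the full count of \<open>p\<close>. On a reversed word the function counts the
  \<open>p\<close> after the last \<open>q\<close>.\<close>

definition before_first :: "'a \<Rightarrow> 'a \<Rightarrow> 'a list \<Rightarrow> nat" where
  "before_first p q w = count_list (takeWhile (\<lambda>z. z \<noteq> q) w) p"

definition same_profile :: "'a list \<Rightarrow> 'a list \<Rightarrow> bool" where
  "same_profile u v \<longleftrightarrow> (\<forall>p. count_list u p = count_list v p) \<and>
     (\<forall>p q. p \<noteq> q \<longrightarrow> before_first p q u = before_first p q v \<and>
        before_first p q (rev u) = before_first p q (rev v))"

lemma before_first_append:
  "before_first p q (u @ v) =
     (if q \<in> set u then before_first p q u else count_list u p + before_first p q v)"
proof -
  have "takeWhile (\<lambda>z. z \<noteq> q) u = u" if "q \<notin> set u"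
    using that by (auto simp: takeWhile_eq_all_conv)
  then show ?thesis by (auto simp: before_first_def takeWhile_append)
qed

lemma before_first_Cons:
  "before_first p q (c # v) =
     (if c = q then 0 else (if c = p then 1 else 0) + before_first p q v)"
  by (simp add: before_first_def)

lemma before_first_Nil: "before_first p q [] = 0"
  by (simp add: before_first_def)

lemma before_first_le: "before_first p q u \<le> count_list u p"
  by (induction u) (auto simp: before_first_Nil before_first_Cons)

lemma same_profile_trans: "same_profile u v \<Longrightarrow> same_profile v w \<Longrightarrow> same_profile u w"
  by (simp add: same_profile_def)

text \<open>Both exchanged letters occur on either side, so the exchanged pair never contains the
  first or last occurrence of a letter. A scan from either end thus stops before the pair or passes
  over both of its letters.\<close>

lemma mid_swap_same_profile: "mid_swap u v \<Longrightarrow> same_profile u v"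
  by (induction rule: mid_swap.induct)
    (auto simp: same_profile_def before_first_append before_first_Cons)

lemma mid_swaps_same_profile: "mid_swap\<^sup>*\<^sup>* u v \<Longrightarrow> same_profile u v"
proof (induction rule: rtranclp_induct)
  case base
  show ?case by (simp add: same_profile_def)
next
  case (step v w)
  then show ?case using mid_swap_same_profile same_profile_trans by blast
qed

text \<open>The common prefix \<open>w\<close> grows letter by letter: the first \<open>a\<close> of
  \<open>v\<close> is moved left to stand directly after \<open>w\<close>. The profile forces every
  letter that it crosses to be exchangeable with it.\<close>

lemma same_profile_mid_swap:
  assumes "same_profile (w @ u) (w @ v)"
  shows "mid_swap\<^sup>*\<^sup>* (w @ v) (w @ u)"
  using assms
proof (induction u arbitrary: w v)
  case Nil
  then have "count_list v p = 0" for p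
    by (auto simp: same_profile_def)
  then have "v = []"
    by (cases v) (auto dest: meta_spec[of _ "hd v"])
  then show ?case by simp
next
  case (Cons a u)
  let ?u = "w @ a # u" and ?v = "w @ v"
  have cnt: "count_list (a # u) p = count_list v p" for p
    using Cons.prems by (simp add: same_profile_def)
  have fst: "before_first p q ?u = before_first p q ?v" if "p \<noteq> q" for p q
    using Cons.prems that by (simp add: same_profile_def)
  have lst: "before_first p q (rev ?u) = before_first p q (rev ?v)" if "p \<noteq> q" for p q
    using Cons.prems that by (simp add: same_profile_def)
  have "a \<in> set v"
    using cnt[of a] by (metis count_list_0_iff list.set_intros(1))
  then obtain v1 v2 where v: "v = v1 @ a # v2" and a1: "a \<notin> set v1"
    by (meson split_list_first)
  \<comment> \<open>If one of the four memberships fails, some entry of the profile differs.\<close>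
  have 1: "a \<in> set w \<and> c \<in> set w \<and> a \<in> set v2 \<and> c \<in> set v2" if c: "c \<in> set v1" for c
  proof (intro conjI)
    have ca: "c \<noteq> a" using c a1 by auto
    have pos: "0 < count_list v1 c" using c by (metis count_list_0_iff gr0I)
    have c_u: "c \<in> set u"
      using cnt[of c] pos ca v by (metis count_list_0_iff count_list.simps(2) count_list_append add_is_0 not_gr_zero)
    \<comment> \<open>Otherwise the \<open>c\<close> in \<open>v1\<close> precede the first
      \<open>a\<close> of \<open>?v\<close>, but not that of \<open>?u\<close>.\<close>
    show "a \<in> set w"
      using fst[OF ca] pos a1 ca by (auto simp: v before_first_append before_first_Cons split: if_splits)
    \<comment> \<open>Otherwise the displayed \<open>a\<close> precedes the first \<open>c\<close>
      of \<open>?u\<close>, while in \<open>?v\<close> that \<open>c\<close> lies in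
      \<open>v1\<close>, with only the \<open>a\<close> of \<open>w\<close> before it.\<close>
    show "c \<in> set w"
      using fst[OF ca[symmetric]] c a1 ca
        before_first_le[of a c v1]
      by (auto simp: v before_first_append before_first_Cons split: if_splits)
    \<comment> \<open>Otherwise the displayed \<open>a\<close> is the last one in both words. It is
      followed by all \<open>c\<close> of \<open>u\<close>, but in \<open>?v\<close> those of
      \<open>v1\<close> come before it.\<close>
    show "a \<in> set v2"
    proof (rule ccontr)
      assume "a \<notin> set v2"
      with cnt[of a] v a1 have "a \<notin> set u"
        by (auto simp: count_list_0_iff)
      with lst[OF ca] cnt[of c] \<open>a \<notin> set v2\<close> pos ca show False
        by (auto simp: v before_first_append before_first_Cons split: if_splits)
    qed
    \<comment> \<open>Otherwise the last \<open>c\<close> of \<open>?v\<close> lies in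
      \<open>v1\<close> and all \<open>a\<close> of \<open>v\<close> follow it. In \<open>?u\<close>
      the last \<open>c\<close> lies in \<open>u\<close>, so the displayed \<open>a\<close> comes
      before it.\<close>
    show "c \<in> set v2"
    proof (rule ccontr)
      assume "c \<notin> set v2"
      with lst[OF ca[symmetric]] cnt[of a] c c_u a1 ca before_first_le[of a c "rev u"]
      show False
        by (auto simp: v before_first_append before_first_Cons split: if_splits)
    qed
  qed
  have move: "mid_swap\<^sup>*\<^sup>* ?v ((w @ [a]) @ v1 @ v2)"
  proof (cases "v1 = []")
    case True
    then show ?thesis by (simp add: v)
  next
    case False
    then obtain c where "c \<in> set v1" by fastforce
    with 1 have "insert a (set v1) \<subseteq> set w" "insert a (set v1) \<subseteq> set v2"
      by blast+
    from mid_swap_move[OF this] show ?thesis by (simp add: v)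
  qed
  have "same_profile ((w @ [a]) @ u) ((w @ [a]) @ v1 @ v2)"
    using same_profile_trans[OF Cons.prems mid_swaps_same_profile[OF move]] by simp
  from Cons.IH[OF this] move show ?case by simp
qed

section \<open>Invariants of the Baxter congruence\<close>

lemma takeWhile_append_if:
  "takeWhile P (u @ v) = (if \<forall>z\<in>set u. P z then u @ takeWhile P v else takeWhile P u)"
  by (induction u) auto

text \<open>The three alternatives: the scan stops before the pair, the scan passes both letters, or
  neither letter is counted.\<close>

lemma count_takeWhile_swap:
  assumes "(\<exists>z\<in>set u. \<not> P z) \<or> (P x \<and> P y) \<or> (x \<noteq> e \<and> y \<noteq> e)"
  shows "count_list (takeWhile P (u @ [x, y] @ v)) e = count_list (takeWhile P (u @ [y, x] @ v)) e"
proof (cases "\<forall>z\<in>set u. P z")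
  case True
  then have tw: "takeWhile P (u @ w) = u @ takeWhile P w" for w
    by (simp add: takeWhile_append2)
  have "(P x \<and> P y) \<or> (x \<noteq> e \<and> y \<noteq> e)" using True assms by blast
  then show ?thesis unfolding tw by (cases "P x"; cases "P y") simp_all
next
  case False
  then show ?thesis by (simp only: takeWhile_append_if if_False)
qed

text \<open>Consider a relation that exchanges \<open>a'\<close> and \<open>d'\<close>, with
  \<open>a' < d'\<close>. If \<open>a' = a\<close>, the letter to the left of the pair that the
  relation prescribes exceeds \<open>a\<close>: it is at most \<open>d\<close> and stops the scan,
  or it exceeds \<open>d\<close>, and then \<open>d'\<close> lies outside the interval as well. If
  \<open>d' = a\<close>, both letters lie outside. The scan from the right is symmetric.\<close>

lemma baxter_cong_invariants:
  assumes "baxter_cong n w w'"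
  shows "mset w = mset w'"
    and "count_list (takeWhile (\<lambda>z. z \<notin> {a<..d}) w) a =
         count_list (takeWhile (\<lambda>z. z \<notin> {a<..d}) w') a"
    and "count_list (takeWhile (\<lambda>z. z \<notin> {a..<d}) (rev w)) d =
         count_list (takeWhile (\<lambda>z. z \<notin> {a..<d}) (rev w')) d"
proof -
  \<comment> \<open>The invariants are proved jointly: for a product, \<open>mset\<close> decides
    whether the scan passes the whole first factor and how much it counts there.\<close>
  have "mset w = mset w' \<and>
    count_list (takeWhile (\<lambda>z. z \<notin> {a<..d}) w) a =
         count_list (takeWhile (\<lambda>z. z \<notin> {a<..d}) w') a \<and>
    count_list (takeWhile (\<lambda>z. z \<notin> {a..<d}) (rev w)) d =
         count_list (takeWhile (\<lambda>z. z \<notin> {a..<d}) (rev w')) d"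
    using assms
  proof (induction rule: baxter_cong.induct)
    case (cong w w' z z')
    have "set w = set w'" "set z = set z'"
      using cong.IH by (metis set_mset_mset)+
    moreover have "count_list w c = count_list w' c" "count_list z c = count_list z' c" for c
      using cong.IH by (metis count_mset)+
    ultimately show ?case using cong.IH by (auto simp: takeWhile_append_if)
  next
    case (rel1 a' b c d' u v)
    have "count_list (takeWhile (\<lambda>z. z \<notin> {a<..d}) (([c] @ u) @ [a', d'] @ v @ [b])) a =
        count_list (takeWhile (\<lambda>z. z \<notin> {a<..d}) (([c] @ u) @ [d', a'] @ v @ [b])) a"
      by (rule count_takeWhile_swap) (use rel1 in auto)
    moreover have "count_list (takeWhile (\<lambda>z. z \<notin> {a..<d}) (([b] @ rev v) @ [d', a'] @ rev u @ [c])) d =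
        count_list (takeWhile (\<lambda>z. z \<notin> {a..<d}) (([b] @ rev v) @ [a', d'] @ rev u @ [c])) d"
      by (rule count_takeWhile_swap) (use rel1 in auto)
    ultimately show ?case by simp
  next
    case (rel2 a' b c d' u v)
    have "count_list (takeWhile (\<lambda>z. z \<notin> {a<..d}) (([b] @ u) @ [d', a'] @ v @ [c])) a =
        count_list (takeWhile (\<lambda>z. z \<notin> {a<..d}) (([b] @ u) @ [a', d'] @ v @ [c])) a"
      by (rule count_takeWhile_swap) (use rel2 in auto)
    moreover have "count_list (takeWhile (\<lambda>z. z \<notin> {a..<d}) (([c] @ rev v) @ [a', d'] @ rev u @ [b])) d =
        count_list (takeWhile (\<lambda>z. z \<notin> {a..<d}) (([c] @ rev v) @ [d', a'] @ rev u @ [b])) d"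
      by (rule count_takeWhile_swap) (use rel2 in auto)
    ultimately show ?case by simp
  qed simp_all
  then show "mset w = mset w'"
    and "count_list (takeWhile (\<lambda>z. z \<notin> {a<..d}) w) a =
         count_list (takeWhile (\<lambda>z. z \<notin> {a<..d}) w') a"
    and "count_list (takeWhile (\<lambda>z. z \<notin> {a..<d}) (rev w)) d =
         count_list (takeWhile (\<lambda>z. z \<notin> {a..<d}) (rev w')) d"
    by blast+
qed

section \<open>Exchanges are valid in the Baxter congruence\<close>

lemma mid_swap_baxter_cong:
  assumes "mid_swap w w'" "w \<in> words n"
  shows "baxter_cong n w w'"
proof -
  have less: "baxter_cong n (u @ [a, d] @ v) (u @ [d, a] @ v)"
    if "{a, d} \<subseteq> set u" "{a, d} \<subseteq> set v" "u @ [a, d] @ v \<in> words n" "a < d" for a d u v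
  proof -
    from that obtain u1 u2 v1 v2 where eq: "u = u1 @ d # u2" "v = v1 @ a # v2"
      by (meson insert_subset split_list)
    \<comment> \<open>This is the degenerate case \<open>b = a\<close>, \<open>c = d\<close> of the
      first relation.\<close>
    have "baxter_cong n ([d] @ u2 @ [a, d] @ v1 @ [a]) ([d] @ u2 @ [d, a] @ v1 @ [a])"
      by (rule baxter_cong.rel1) (use that eq in \<open>auto simp: words_def\<close>)
    moreover have "u1 \<in> words n" "v2 \<in> words n"
      using that(3) eq by (auto simp: words_def)
    then have "baxter_cong n u1 u1" "baxter_cong n v2 v2"
      by (auto intro: baxter_cong.refl)
    ultimately have "baxter_cong n (u1 @ ([d] @ u2 @ [a, d] @ v1 @ [a]) @ v2)
        (u1 @ ([d] @ u2 @ [d, a] @ v1 @ [a]) @ v2)"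
      by (metis baxter_cong.cong)
    then show ?thesis by (simp add: eq)
  qed
  from assms show ?thesis
  proof cases
    case (mid_swapI a b u v)
    consider "a < b" | "a = b" | "b < a" by linarith
    then show ?thesis
    proof cases
      case 1
      then show ?thesis using less[of a b u v] mid_swapI assms by simp
    next
      case 2
      then show ?thesis using mid_swapI assms by (auto intro: baxter_cong.refl)
    next
      case 3
      have "baxter_cong n (u @ [b, a] @ v) (u @ [a, b] @ v)"
        by (rule less) (use 3 mid_swapI assms in \<open>auto simp: words_def\<close>)
      then show ?thesis using mid_swapI by (simp add: baxter_cong.sym)
    qed
  qed
qed

lemma mid_swaps_baxter_cong:
  assumes "mid_swap\<^sup>*\<^sup>* w w'" "w \<in> words n"
  shows "baxter_cong n w w'"
  using assms
proof (induction rule: rtranclp_induct)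
  case base
  then show ?case by (rule baxter_cong.refl)
next
  case (step w' w'')
  then show ?case
    by (meson baxter_cong.trans baxter_cong_words mid_swap_baxter_cong)
qed

text \<open>Each \<open>p\<close> contributes one counted letter, \<open>q\<close> stops the scan,
  and images of other symbols are passed without being counted.\<close>

lemma count_takeWhile_concat_map:
  assumes "g p = [a]" "g q = [d]" "P a" "\<not> P d"
    and "\<And>z. z \<in> set u \<Longrightarrow> z \<noteq> p \<Longrightarrow> z \<noteq> q \<Longrightarrow> \<forall>l\<in>set (g z). P l \<and> l \<noteq> a"
  shows "count_list (takeWhile P (concat (map g u))) a = before_first p q u"
  using assms(5)
proof (induction u)
  case Nil
  show ?case by (simp add: before_first_Nil)
next
  case (Cons z u)
  have IH: "count_list (takeWhile P (concat (map g u))) a = before_first p q u"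
    by (rule Cons.IH) (use Cons.prems in auto)
  consider "z = p" | "z = q" | "\<forall>l\<in>set (g z). P l \<and> l \<noteq> a" "z \<noteq> p" "z \<noteq> q"
    using Cons.prems[of z] by auto
  then show ?case
  proof cases
    case 3
    then have "count_list (g z) a = 0" by (auto simp: count_list_0_iff)
    with 3 IH show ?thesis by (simp add: before_first_Cons)
  qed (use assms(1-4) IH in \<open>auto simp: before_first_Cons\<close>)
qed

lemma count_concat_map:
  assumes "g p = [a]" "\<And>z. z \<in> set u \<Longrightarrow> z \<noteq> p \<Longrightarrow> a \<notin> set (g z)"
  shows "count_list (concat (map g u)) a = count_list u p"
  using assms(2)
proof (induction u)
  case (Cons z u)
  then show ?case using assms(1) by (cases "z = p") (auto simp: count_list_0_iff)
qed simp

section \<open>Words over letters and starred letters\<close>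

definition literals :: "factor set" where
  "literals = range Var \<union> range (\<lambda>x. Star (Var x) [])"

fun literal_word :: "nat \<Rightarrow> (nat \<Rightarrow> nat list) \<Rightarrow> factor \<Rightarrow> nat list" where
  "literal_word n f (Var x) = f x"
| "literal_word n f (Star (Var x) as) = sharp_word n (f x)"
| "literal_word n f (Star (Star a bs) as) = []"

lemma eval_literals:
  assumes "\<And>x. f x \<in> words n" "set u \<subseteq> literals"
  shows "eval_term (baxt n) (\<lambda>x. baxter_rel n `` {f x}) u =
      baxter_rel n `` {concat (map (literal_word n f) u)}"
    and "concat (map (literal_word n f) u) \<in> words n"
proof -
  interpret involution_monoid "baxt n" by (rule involution_monoid_baxt)
  let ?\<theta> = "\<lambda>x. baxter_rel n `` {f x}"
  have \<theta>: "?\<theta> x \<in> carrier (baxt n)" for x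
    using assms(1) by (auto simp: baxt_carrier_class)
  note ev = eval_term_simps[of ?\<theta>, OF \<theta>]
  have "eval_term (baxt n) ?\<theta> u = baxter_rel n `` {concat (map (literal_word n f) u)} \<and>
      concat (map (literal_word n f) u) \<in> words n"
    using assms(2)
  proof (induction u)
    case Nil
    show ?case by (simp add: ev baxt_one_class words_Nil)
  next
    case (Cons a u)
    have a: "literal_word n f a \<in> words n"
      using Cons.prems assms(1) by (auto simp: literals_def sharp_word_words)
    have "eval_term (baxt n) ?\<theta> [a] = baxter_rel n `` {literal_word n f a}"
      using Cons.prems ev(3) ev(5)[of "[Var _]"] assms(1)
      by (auto simp: literals_def baxt_invol_class)
    then show ?case
      using Cons a ev(4)[of "[a]" u] by (simp add: baxt_mult_class words_append)
  qed
  then show "eval_term (baxt n) ?\<theta> u = baxter_rel n `` {concat (map (literal_word n f) u)}"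
    "concat (map (literal_word n f) u) \<in> words n"
    by auto
qed

lemma satisfies_baxter_cong:
  assumes "satisfies (baxt n) u v" "\<And>x. f x \<in> words n" "set u \<subseteq> literals" "set v \<subseteq> literals"
  shows "baxter_cong n (concat (map (literal_word n f) u)) (concat (map (literal_word n f) v))"
proof -
  have "baxter_rel n `` {f x} \<in> carrier (baxt n)" for x
    using assms(2) by (auto simp: baxt_carrier_class)
  then have "baxter_rel n `` {concat (map (literal_word n f) u)} =
      baxter_rel n `` {concat (map (literal_word n f) v)}"
    using assms(1)[unfolded satisfies_def, rule_format, of "\<lambda>x. baxter_rel n `` {f x}"]
    by (simp only: eval_literals(1)[OF assms(2,3)] eval_literals(1)[OF assms(2,4)])
  then have "(concat (map (literal_word n f) u), concat (map (literal_word n f) v)) \<in> baxter_rel n"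
    using eq_equiv_class[OF _ equiv_baxter_rel] eval_literals(2)[of f n v] assms by blast
  then show ?thesis by (simp add: baxter_rel_def)
qed

section \<open>Recovering the profile by substitutions\<close>

fun base :: "factor \<Rightarrow> nat" where
  "base (Var x) = x"
| "base (Star a as) = base a"

lemma separating_substitution:
  assumes "n \<ge> 4" "p \<in> literals" "q \<in> literals" "p \<noteq> q"
  obtains f d where "\<And>x. f x \<in> words n" "literal_word n f p = [1]" "literal_word n f q = [d]" "1 < d"
    "\<And>z. z \<in> literals \<Longrightarrow> z \<noteq> p \<Longrightarrow> z \<noteq> q \<Longrightarrow> set (literal_word n f z) \<inter> {1..d} = {}"
proof -
  \<comment> \<open>For a starred literal the involution turns \<open>n + 1 - i\<close> back into
    \<open>i\<close>.\<close>
  define letter where "letter i a = (case a of Var _ \<Rightarrow> [i] | Star _ _ \<Rightarrow> [n + 1 - i])" for i a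
  \<comment> \<open>Distinct literals with the same base are a letter and its star, so sending
    \<open>p\<close> to \<open>1\<close> forces \<open>q\<close> to \<open>n\<close>. With different
    bases, the partners of \<open>p\<close> and \<open>q\<close> under the star receive
    \<open>n\<close> and \<open>n - 1\<close>, which exceed \<open>2\<close> because
    \<open>n \<ge> 4\<close>.\<close>
  define d where "d = (if base p = base q then n else 2)"
  define f where "f x = (if x = base p then letter 1 p else if x = base q then letter 2 q else [])"
    for x
  show thesis
  proof (rule that[of f d])
    show "f x \<in> words n" for x
      using assms(1) by (auto simp: f_def letter_def words_def split: factor.splits)
    show "literal_word n f p = [1]"
      using assms by (auto simp: literals_def f_def letter_def sharp_word_def)
    show "literal_word n f q = [d]"
      using assms by (auto simp: literals_def f_def letter_def sharp_word_def d_def)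
    show "1 < d" using assms(1) by (simp add: d_def)
    show "set (literal_word n f z) \<inter> {1..d} = {}" if "z \<in> literals" "z \<noteq> p" "z \<noteq> q" for z
      using assms that
      by (auto simp: literals_def f_def letter_def sharp_word_def d_def split: if_splits)
  qed
qed

lemma satisfies_same_profile:
  assumes "n \<ge> 4" "satisfies (baxt n) u v" "set u \<subseteq> literals" "set v \<subseteq> literals"
  shows "same_profile u v"
proof -
  \<comment> \<open>As \<open>p\<close> becomes the smaller letter, it is counted from the left and
    \<open>q\<close> from the right. The two remaining entries come from exchanging the roles of
    \<open>p\<close> and \<open>q\<close>.\<close>
  have lit: "count_list u p = count_list v p \<and> before_first p q u = before_first p q v \<and>
     before_first q p (rev u) = before_first q p (rev v)"
    if pq: "p \<in> literals" "q \<in> literals" "p \<noteq> q" for p q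
  proof -
    obtain f d where f: "\<And>x. f x \<in> words n"
        "literal_word n f p = [1]" "literal_word n f q = [d]" "1 < d"
        "\<And>z. z \<in> literals \<Longrightarrow> z \<noteq> p \<Longrightarrow> z \<noteq> q \<Longrightarrow> set (literal_word n f z) \<inter> {1..d} = {}"
      using separating_substitution[OF assms(1) pq] by metis
    let ?g = "literal_word n f"
    let ?w = "\<lambda>u. concat (map ?g u)"
    have "baxter_cong n (?w u) (?w v)"
      by (rule satisfies_baxter_cong) (use assms f in auto)
    note inv = baxter_cong_invariants[OF this]
    have other: "l \<notin> {1..d}" if "l \<in> set (?g z)" "z \<in> set w" "z \<noteq> p" "z \<noteq> q" "set w \<subseteq> literals"
      for l z w
      using f(5)[of z] that by blast
    have c: "count_list (?w w) 1 = count_list w p" if "set w \<subseteq> literals" for w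
    proof (rule count_concat_map)
      fix z assume "z \<in> set w" "z \<noteq> p"
      then show "1 \<notin> set (?g z)"
        using f(3,4) other[of 1 z w] that by (cases "z = q") auto
    qed (rule f(2))
    have b: "count_list (takeWhile (\<lambda>z. z \<notin> {1<..d}) (?w w)) 1 = before_first p q w"
      if "set w \<subseteq> literals" for w
    proof (rule count_takeWhile_concat_map[where d = d])
      fix z assume "z \<in> set w" "z \<noteq> p" "z \<noteq> q"
      then show "\<forall>l\<in>set (?g z). l \<notin> {1<..d} \<and> l \<noteq> 1"
        using other[of _ z w] that f(4) by fastforce
    qed (use f in auto)
    have e: "count_list (takeWhile (\<lambda>z. z \<notin> {1..<d}) (rev (?w w))) d = before_first q p (rev w)"
      if "set w \<subseteq> literals" for w
    proof -
      have "rev (?w w) = concat (map (\<lambda>z. rev (?g z)) (rev w))"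
        by (simp add: rev_concat rev_map comp_def)
      moreover have "count_list (takeWhile (\<lambda>z. z \<notin> {1..<d})
          (concat (map (\<lambda>z. rev (?g z)) (rev w)))) d = before_first q p (rev w)"
      proof (rule count_takeWhile_concat_map[where d = 1])
        fix z assume "z \<in> set (rev w)" "z \<noteq> q" "z \<noteq> p"
        then show "\<forall>l\<in>set (rev (?g z)). l \<notin> {1..<d} \<and> l \<noteq> d"
          using other[of _ z w] that f(4) by fastforce
      qed (use f in auto)
      ultimately show ?thesis by simp
    qed
    show ?thesis
      using inv(1) inv(2)[of 1 d] inv(3)[of 1 d] b c e assms(3,4) by (metis count_mset)
  qed
  have cnt: "count_list u p = count_list v p" for p
  proof (cases "p \<in> literals")
    case True
    \<comment> \<open>\<open>lit\<close> speaks of pairs, so any second literal gives the count of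
      \<open>p\<close>.\<close>
    obtain q where "q \<in> literals" "p \<noteq> q"
      by (metis UnI1 literals_def n_not_Suc_n factor.inject(1) rangeI)
    with True lit show ?thesis by blast
  next
    case False
    then have "p \<notin> set u" "p \<notin> set v" using assms(3,4) by auto
    then show ?thesis by (simp add: count_list_0_iff)
  qed
  have out: "before_first p q w = 0" if "p \<notin> set w" for p q and w :: iterm
    using before_first_le[of p q w] that by (simp add: count_list_0_iff)
  have out': "before_first p q w = count_list w p" if "q \<notin> set w" for p q and w :: iterm
    using before_first_append[of p q w "[]"] that by (simp add: before_first_Nil)
  have "before_first p q u = before_first p q v \<and> before_first p q (rev u) = before_first p q (rev v)"
    if "p \<noteq> q" for p q
  proof (cases "p \<in> literals \<and> q \<in> literals")
    case True
    then show ?thesis using lit[of p q] lit[of q p] that by auto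
  next
    case False
    then consider "p \<notin> set u" "p \<notin> set v" | "q \<notin> set u" "q \<notin> set v"
      using assms(3,4) by blast
    then show ?thesis using cnt by cases (auto simp: out out')
  qed
  with cnt show ?thesis by (simp add: same_profile_def)
qed

section \<open>Deductions\<close>

lemma deducible_refl: "deducible \<Sigma> s s"
  by (simp add: deducible_def)

lemma deducible_trans: "deducible \<Sigma> s t \<Longrightarrow> deducible \<Sigma> t u \<Longrightarrow> deducible \<Sigma> s u"
  by (simp add: deducible_def)

lemma replaces_sym: "replaces p q s t \<Longrightarrow> replaces q p t s"
  by (induction rule: replaces.induct) (auto intro: replaces.intros)

lemma deducible_sym: "deducible \<Sigma> s t \<Longrightarrow> deducible \<Sigma> t s"
proof -
  have "directly_deducible p q s t \<Longrightarrow> directly_deducible q p t s" for p q s t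
    unfolding directly_deducible_def using replaces_sym by blast
  then have "symp (\<lambda>s t. \<exists>(p, q) \<in> \<Sigma>. directly_deducible p q s t \<or> directly_deducible q p s t)"
    unfolding symp_def by blast
  then show "deducible \<Sigma> s t \<Longrightarrow> deducible \<Sigma> t s"
    unfolding deducible_def by (rule sympD[OF symp_rtranclp])
qed

lemma deducible_map:
  assumes "deducible \<Sigma> s t" "\<And>p q s t. replaces p q s t \<Longrightarrow> replaces p q (F s) (F t)"
  shows "deducible \<Sigma> (F s) (F t)"
  using assms(1) unfolding deducible_def
proof (induction rule: rtranclp_induct)
  case (step t u)
  then have "\<exists>(p, q) \<in> \<Sigma>. directly_deducible p q (F t) (F u) \<or> directly_deducible q p (F t) (F u)"
    unfolding directly_deducible_def using assms(2) by blast
  with step.IH show ?case by (rule rtranclp.rtrancl_into_rtrancl)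
qed simp

lemma deducible_context: "deducible \<Sigma> s t \<Longrightarrow> deducible \<Sigma> (u @ s @ v) (u @ t @ v)"
  by (rule deducible_map) (auto intro: replaces.conc)

lemma deducible_star: "deducible \<Sigma> s t \<Longrightarrow> deducible \<Sigma> (star s) (star t)"
  by (rule deducible_map) (auto intro: replaces.star)

lemma deducible_conc:
  assumes "deducible \<Sigma> s t" "deducible \<Sigma> u v"
  shows "deducible \<Sigma> (s @ u) (t @ v)"
  using deducible_context[OF assms(1), of "[]" u] deducible_context[OF assms(2), of t "[]"]
  by (auto intro: deducible_trans)

lemma deducible_instance:
  assumes "(p, q) \<in> \<Sigma>"
  shows "deducible \<Sigma> (subst_term \<phi> p) (subst_term \<phi> q)"
proof -
  have "directly_deducible p q (subst_term \<phi> p) (subst_term \<phi> q)"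
    unfolding directly_deducible_def by (auto intro: replaces.here)
  with assms show ?thesis unfolding deducible_def by blast
qed

text \<open>Distinctness allows the six letters to be substituted independently.\<close>

locale baxter_identities =
  fixes x y h k s t :: nat
  assumes dist: "distinct [x, y, h, k, s, t]"
begin

definition \<Sigma> :: "(iterm \<times> iterm) set" where
  "\<Sigma> = {(star (star [Var x]), [Var x]),
     (star [Var x, Var y], star [Var y] @ star [Var x]),
     (map Var [x, h, y, k, x, y, s, x, t, y], map Var [x, h, y, k, y, x, s, x, t, y]),
     (map Var [x, h, y, k, x, y, s, y, t, x], map Var [x, h, y, k, y, x, s, y, t, x])}"

lemma deducible_star_star: "deducible \<Sigma> (star (star a)) a"
  using deducible_instance[of "star (star [Var x])" "[Var x]" \<Sigma> "\<lambda>_. a"]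
  unfolding \<Sigma>_def subst_term_simps by blast

lemma deducible_star_conc: "deducible \<Sigma> (star (a @ b)) (star b @ star a)"
proof -
  define \<phi> where "\<phi> = (\<lambda>_. [])(x := a, y := b)"
  have "subst_term \<phi> (star ([Var x] @ [Var y])) = star (a @ b)"
    "subst_term \<phi> (star [Var y] @ star [Var x]) = star b @ star a"
    unfolding subst_term_simps using dist by (auto simp: \<phi>_def)
  then show ?thesis
    using deducible_instance[of "star [Var x, Var y]" "star [Var y] @ star [Var x]" \<Sigma> \<phi>]
    by (simp add: \<Sigma>_def)
qed

lemma deducible_swap_same_order:
  "deducible \<Sigma> (a @ H @ b @ K @ a @ b @ S @ a @ T @ b) (a @ H @ b @ K @ b @ a @ S @ a @ T @ b)"
proof -
  define \<phi> where "\<phi> = (\<lambda>_. [])(x := a, y := b, h := H, k := K, s := S, t := T)"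
  have "\<phi> x = a" "\<phi> y = b" "\<phi> h = H" "\<phi> k = K" "\<phi> s = S" "\<phi> t = T"
    using dist by (auto simp: \<phi>_def)
  then show ?thesis
    using deducible_instance[of "map Var [x, h, y, k, x, y, s, x, t, y]"
        "map Var [x, h, y, k, y, x, s, x, t, y]" \<Sigma> \<phi>]
    by (simp add: \<Sigma>_def subst_term_def)
qed

lemma deducible_swap_opposite_order:
  "deducible \<Sigma> (a @ H @ b @ K @ a @ b @ S @ b @ T @ a) (a @ H @ b @ K @ b @ a @ S @ b @ T @ a)"
proof -
  define \<phi> where "\<phi> = (\<lambda>_. [])(x := a, y := b, h := H, k := K, s := S, t := T)"
  have "\<phi> x = a" "\<phi> y = b" "\<phi> h = H" "\<phi> k = K" "\<phi> s = S" "\<phi> t = T"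
    using dist by (auto simp: \<phi>_def)
  then show ?thesis
    using deducible_instance[of "map Var [x, h, y, k, x, y, s, y, t, x]"
        "map Var [x, h, y, k, y, x, s, y, t, x]" \<Sigma> \<phi>]
    by (simp add: \<Sigma>_def subst_term_def)
qed

text \<open>One occurrence of \<open>a\<close> and of \<open>b\<close> is chosen on each side.
  Whether their orders on the two sides agree decides which exchange identity applies; the gaps
  between them are the values of \<open>h\<close>, \<open>k\<close>, \<open>s\<close>,
  \<open>t\<close>.\<close>

lemma mid_swap_deducible:
  assumes "mid_swap u v"
  shows "deducible \<Sigma> u v"
  using assms
proof cases
  case (mid_swapI a b u1 u2)
  have two: "(\<exists>w1 w2 w3. w = w1 @ [a] @ w2 @ [b] @ w3) \<or> (\<exists>w1 w2 w3. w = w1 @ [b] @ w2 @ [a] @ w3)"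
    if ab: "{a, b} \<subseteq> set w" "a \<noteq> b" for w
  proof -
    obtain w1 w2 where w: "w = w1 @ a # w2" using ab by (meson insert_subset split_list)
    with ab consider "b \<in> set w1" | "b \<in> set w2" by auto
    then show ?thesis
    proof cases
      case 1
      then obtain v1 v2 where "w1 = v1 @ b # v2" by (meson split_list)
      with w have "w = v1 @ [b] @ v2 @ [a] @ w2" by simp
      then show ?thesis by blast
    next
      case 2
      then obtain v1 v2 where "w2 = v1 @ b # v2" by (meson split_list)
      with w have "w = w1 @ [a] @ v1 @ [b] @ v2" by simp
      then show ?thesis by blast
    qed
  qed
  show ?thesis
  proof (cases "a = b")
    case True
    then show ?thesis using mid_swapI by (simp add: deducible_refl)
  next
    case False
    have step: "deducible \<Sigma> (P @ Q @ R) (P @ Q' @ R)" if "deducible \<Sigma> Q Q' \<or> deducible \<Sigma> Q' Q"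
      for P Q Q' R
      using that deducible_context deducible_sym by blast
    from two[OF mid_swapI(3) False] two[OF mid_swapI(4) False]
    consider
      (ab_ab) w1 w2 w3 z1 z2 z3 where "u1 = w1 @ [a] @ w2 @ [b] @ w3" "u2 = z1 @ [a] @ z2 @ [b] @ z3"
    | (ab_ba) w1 w2 w3 z1 z2 z3 where "u1 = w1 @ [a] @ w2 @ [b] @ w3" "u2 = z1 @ [b] @ z2 @ [a] @ z3"
    | (ba_ab) w1 w2 w3 z1 z2 z3 where "u1 = w1 @ [b] @ w2 @ [a] @ w3" "u2 = z1 @ [a] @ z2 @ [b] @ z3"
    | (ba_ba) w1 w2 w3 z1 z2 z3 where "u1 = w1 @ [b] @ w2 @ [a] @ w3" "u2 = z1 @ [b] @ z2 @ [a] @ z3"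
      by metis
    then show ?thesis
    proof cases
      case ab_ab
      then show ?thesis
        using mid_swapI(1,2)
          step[OF disjI1[OF deducible_swap_same_order[of "[a]" w2 "[b]" w3 z1 z2]], of w1 z3]
        by simp
    next
      case ab_ba
      then show ?thesis
        using mid_swapI(1,2)
          step[OF disjI1[OF deducible_swap_opposite_order[of "[a]" w2 "[b]" w3 z1 z2]], of w1 z3]
        by simp
    next
      \<comment> \<open>With \<open>b\<close> first on the left, \<open>b\<close> takes the role of
        \<open>x\<close>, and the identity is applied from right to left.\<close>
      case ba_ab
      then show ?thesis
        using mid_swapI(1,2)
          step[OF disjI2[OF deducible_swap_opposite_order[of "[b]" w2 "[a]" w3 z1 z2]], of w1 z3]
        by simp
    next
      case ba_ba
      then show ?thesis
        using mid_swapI(1,2)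
          step[OF disjI2[OF deducible_swap_same_order[of "[b]" w2 "[a]" w3 z1 z2]], of w1 z3]
        by simp
    qed
  qed
qed

lemma mid_swaps_deducible: "mid_swap\<^sup>*\<^sup>* u v \<Longrightarrow> deducible \<Sigma> u v"
  by (induction rule: rtranclp_induct)
    (auto intro: deducible_refl deducible_trans mid_swap_deducible)

text \<open>Validity carries a satisfied identity over to normal forms, and deducibility carries the
  deduction back.\<close>

definition equal_terms :: "('a, 'b) invol_monoid_scheme \<Rightarrow> iterm \<Rightarrow> iterm \<Rightarrow> bool" where
  "equal_terms M a b \<longleftrightarrow> deducible \<Sigma> a b \<and> satisfies M a b"

lemma equal_terms_refl: "equal_terms M a a"
  by (simp add: equal_terms_def deducible_refl satisfies_def)

lemma equal_terms_trans: "equal_terms M a b \<Longrightarrow> equal_terms M b c \<Longrightarrow> equal_terms M a c"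
  unfolding equal_terms_def satisfies_def by (metis deducible_trans)

section \<open>Normal forms over literals\<close>

context
  fixes M :: "('a, 'b) invol_monoid_scheme"
  assumes M: "involution_monoid M"
begin

interpretation involution_monoid M by (rule M)

lemma equal_terms_conc: "equal_terms M a b \<Longrightarrow> equal_terms M c d \<Longrightarrow> equal_terms M (a @ c) (b @ d)"
  by (auto simp: equal_terms_def satisfies_def eval_term_simps(4) deducible_conc)

lemma equal_terms_star: "equal_terms M a b \<Longrightarrow> equal_terms M (star a) (star b)"
  by (auto simp: equal_terms_def satisfies_def eval_term_simps(5) deducible_star)

lemma equal_terms_star_star: "equal_terms M (star (star a)) a"
  by (auto simp: equal_terms_def satisfies_def eval_term_simps(1,5) deducible_star_star invol_invol)

lemma equal_terms_star_conc: "equal_terms M (star (a @ b)) (star b @ star a)"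
  by (auto simp: equal_terms_def satisfies_def eval_term_simps(1,4,5) deducible_star_conc invol_mult)

lemma star_literals_normal_form:
  assumes "set a \<subseteq> literals"
  shows "\<exists>b. set b \<subseteq> literals \<and> equal_terms M (star a) b"
  using assms
proof (induction a)
  case Nil
  show ?case by (intro exI[of _ "[]"]) (simp add: equal_terms_refl)
next
  case (Cons c a)
  then obtain b where b: "set b \<subseteq> literals" "equal_terms M (star a) b" by auto
  have "\<exists>e. set e \<subseteq> literals \<and> equal_terms M (star [c]) e"
  proof -
    from Cons.prems consider z where "c = Var z" | z where "c = Star (Var z) []"
      by (auto simp: literals_def)
    then show ?thesis
    proof cases
      case (1 z)
      then show ?thesis
        by (intro exI[of _ "star [c]"]) (simp add: literals_def equal_terms_refl)
    next
      case (2 z)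
      then have "equal_terms M (star [c]) [Var z]"
        using equal_terms_star_star[of "[Var z]"] by simp
      then show ?thesis by (intro exI[of _ "[Var z]"]) (simp add: literals_def)
    qed
  qed
  then obtain e where e: "set e \<subseteq> literals" "equal_terms M (star [c]) e" by blast
  \<comment> \<open>The star reverses products, so the normal form \<open>b\<close> of
    \<open>star a\<close> comes first.\<close>
  have "equal_terms M (star ([c] @ a)) (b @ e)"
    using equal_terms_star_conc equal_terms_conc[OF b(2) e(2)] by (rule equal_terms_trans)
  with b(1) e(1) show ?case by (intro exI[of _ "b @ e"]) simp
qed

lemma literal_normal_form: "\<exists>b. set b \<subseteq> literals \<and> equal_terms M a b"
proof (induction a rule: iterm_induct)
  case empty
  show ?case by (intro exI[of _ "[]"]) (simp add: equal_terms_refl)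
next
  case (var z)
  show ?case by (intro exI[of _ "[Var z]"]) (simp add: literals_def equal_terms_refl)
next
  case (conc a b)
  then obtain a' b' where "set a' \<subseteq> literals" "equal_terms M a a'"
    "set b' \<subseteq> literals" "equal_terms M b b'" by blast
  then show ?case by (intro exI[of _ "a' @ b'"]) (simp add: equal_terms_conc)
next
  case (star a)
  then obtain a' where a': "set a' \<subseteq> literals" "equal_terms M a a'" by blast
  from star_literals_normal_form[OF a'(1)] show ?case
    using equal_terms_trans[OF equal_terms_star[OF a'(2)]] by blast
qed

end

section \<open>Completeness and soundness of the identities\<close>

lemma satisfies_deducible:
  assumes "n \<ge> 4" "satisfies (baxt n) a b"
  shows "deducible \<Sigma> a b"
proof -
  obtain u v where u: "set u \<subseteq> literals" "equal_terms (baxt n) a u"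
    and v: "set v \<subseteq> literals" "equal_terms (baxt n) b v"
    using literal_normal_form[OF involution_monoid_baxt] by metis
  \<comment> \<open>The order is reversed because \<open>same_profile_mid_swap\<close> rewrites its
    second word into its first.\<close>
  have "satisfies (baxt n) v u"
    using assms(2) u(2) v(2) by (simp add: equal_terms_def satisfies_def)
  then have "same_profile v u"
    by (rule satisfies_same_profile[OF assms(1) _ v(1) u(1)])
  then have "mid_swap\<^sup>*\<^sup>* u v"
    using same_profile_mid_swap[of "[]" v u] by simp
  then have "deducible \<Sigma> u v" by (rule mid_swaps_deducible)
  with u(2) v(2) show ?thesis
    unfolding equal_terms_def by (metis deducible_trans deducible_sym)
qed

text \<open>Every assignment into the quotient is given by representatives \<open>f\<close>, so
  soundness reduces to exchanges between substituted words.\<close>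

lemma satisfies_mid_swap:
  assumes "\<And>f :: nat \<Rightarrow> nat list. mid_swap\<^sup>*\<^sup>* (concat (map f zs)) (concat (map f zs'))"
  shows "satisfies (baxt n) (map Var zs) (map Var zs')"
  unfolding satisfies_def
proof (intro allI impI)
  fix \<theta> :: "nat \<Rightarrow> nat list set"
  assume "\<forall>z. \<theta> z \<in> carrier (baxt n)"
  then obtain f where f: "\<And>z. f z \<in> words n" "\<And>z. \<theta> z = baxter_rel n `` {f z}"
    unfolding baxt_carrier_class by metis
  then have \<theta>: "\<theta> = (\<lambda>z. baxter_rel n `` {f z})" by auto
  have lit: "set (map Var us) \<subseteq> literals" for us by (auto simp: literals_def)
  have map: "map (literal_word n f) (map Var us) = map f us" for us by simp
  note ev = eval_literals[of f n, OF f(1) lit, unfolded map]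
  have "baxter_cong n (concat (map f zs)) (concat (map f zs'))"
    by (rule mid_swaps_baxter_cong[OF assms ev(2)])
  then have "(concat (map f zs), concat (map f zs')) \<in> baxter_rel n"
    by (simp add: baxter_rel_def)
  then show "eval_term (baxt n) \<theta> (map Var zs) = eval_term (baxt n) \<theta> (map Var zs')"
    unfolding \<theta> ev(1) by (rule equiv_class_eq[OF equiv_baxter_rel])
qed

lemma satisfies_\<Sigma>:
  assumes "(p, q) \<in> \<Sigma>"
  shows "satisfies (baxt n) p q"
proof -
  note equal = equal_terms_star_star[OF involution_monoid_baxt[of n]]
    equal_terms_star_conc[OF involution_monoid_baxt[of n]]
  have "satisfies (baxt n) (star (star [Var x])) [Var x]"
    using equal(1)[of "[Var x]"] by (simp only: equal_terms_def)
  moreover have "satisfies (baxt n) (star [Var x, Var y]) (star [Var y] @ star [Var x])"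
    using equal(2)[of "[Var x]" "[Var y]"] by (simp add: equal_terms_def)
  moreover have "satisfies (baxt n) (map Var [x, h, y, k, x, y, s, x, t, y])
      (map Var [x, h, y, k, y, x, s, x, t, y])"
  proof (rule satisfies_mid_swap)
    fix f :: "nat \<Rightarrow> nat list"
    show "mid_swap\<^sup>*\<^sup>* (concat (map f [x, h, y, k, x, y, s, x, t, y]))
      (concat (map f [x, h, y, k, y, x, s, x, t, y]))"
      \<comment> \<open>Both contexts contain \<open>f x\<close> and \<open>f y\<close>, hence every
        letter of the exchanged blocks.\<close>
      using mid_swap_blocks[of "f x" "f y" "f x @ f h @ f y @ f k" "f s @ f x @ f t @ f y"]
      by auto
  qed
  moreover have "satisfies (baxt n) (map Var [x, h, y, k, x, y, s, y, t, x])
      (map Var [x, h, y, k, y, x, s, y, t, x])"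
  proof (rule satisfies_mid_swap)
    fix f :: "nat \<Rightarrow> nat list"
    show "mid_swap\<^sup>*\<^sup>* (concat (map f [x, h, y, k, x, y, s, y, t, x]))
      (concat (map f [x, h, y, k, y, x, s, y, t, x]))"
      using mid_swap_blocks[of "f x" "f y" "f x @ f h @ f y @ f k" "f s @ f y @ f t @ f x"]
      by auto
  qed
  ultimately show ?thesis
    using assms unfolding \<Sigma>_def by blast
qed

end

theorem theorem5p6:
  fixes n x y h k s t :: nat
  assumes "n \<ge> 4"
    and "distinct [x, y, h, k, s, t]"
  shows "identity_basis (baxt n)
    {(star (star [Var x]), [Var x]),
     (star [Var x, Var y], star [Var y] @ star [Var x]),
     (map Var [x, h, y, k, x, y, s, x, t, y], map Var [x, h, y, k, y, x, s, x, t, y]),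
     (map Var [x, h, y, k, x, y, s, y, t, x], map Var [x, h, y, k, y, x, s, y, t, x])}"
proof -
  interpret baxter_identities x y h k s t by standard (rule assms(2))
  have "p \<noteq> [] \<and> q \<noteq> []" if "(p, q) \<in> \<Sigma>" for p q
    using that by (auto simp: \<Sigma>_def)
  then have "identity_basis (baxt n) \<Sigma>"
    unfolding identity_basis_def
    using satisfies_\<Sigma>[of _ _ n] satisfies_deducible[OF assms(1)] by blast
  then show ?thesis unfolding \<Sigma>_def .
qed

end
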